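(* Consider the assortment (and pricing) problem where demand may be non-stationary, under either the static substitution model (integral or fractional demand) or the dynamic substitution model (integral demand), and assume the substitutability condition holds. Then Algorithm 2 earns expected revenue at least $\mathsf{OPT}_{\mathrm{LP}}/2$, where $\mathsf{OPT}_{\mathrm{LP}}$ is the optimal value of CDLP-N.
   Context: Model. A firm sells $n$ items over $T$ periods; item $i$ has starting inventory $b_i$ ($1\le b_i\le T$; integer for integral demand). Prices $p_1,\dots,p_m>0$; products are pairs $(i,j)$. $\mathcal S$ is a downward-closed family of subsets of $[n]\times[m]$ (assortments), $\emptyset\in\mathcal S$. A static policy fixes at the start (possibly randomly, independently of sales) assortments $S_1,\dots,S_T$. Demands are independent across periods. Integral demand: customer $t$ seeing $S$ chooses $(i,j)\in S$ with probability $q_t(i,j,S)$, $\sum_{(i,j)\in S}q_t(i,j,S)\le1$. Static substitution: customer sees all of $S_t$; if the chosen item is out of stock, no sale. Dynamic substitution: customer sees only in-stock products of $S_t$ and chooses according to $q_t$ at that subset. Fractional demand (static substitution only): when $S$ is shown in period $t$ a random vector of quantities in $[0,1]^{|S|}$ is demanded (distribution depending only on $t,S$), never positive for two distinct products of the same item; sales of $(i,j)$ are the minimum of its demanded quantity and item $i$'s remaining inventory; $q_t(i,j,S)$ is the expected demanded quantity. Substitutability: $q_t(i,j,S')\ge q_t(i,j,S)$ for all $t$, $S\in\mathcal S$, $S'\subseteq S$, $(i,j)\in S'$. CDLP-N: maximize $\sum_{t=1}^T\sum_{S\in\mathcal S}x_t(S)\sum_{(i,j)\in S}p_jq_t(i,j,S)$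 subject to $\sum_t\sum_S x_t(S)\sum_{j:(i,j)\in S}q_t(i,j,S)\le b_i$ for all $i$, $\sum_S x_t(S)=1$ for all $t$, $x_t(S)\ge0$. Algorithm 2: solve CDLP-N, obtaining an optimal $x^*$; let $r^*_i=\sum_t\sum_S x^*_t(S)\sum_{j:(i,j)\in S}p_jq_t(i,j,S)$. Independently for each $t$, draw $\tilde S_t=S$ with probability $x^*_t(S)$, and offer $S_t=\{(i,j)\in\tilde S_t: p_j>r^*_i/(2b_i)\}$. *)

theory Defs
  imports "HOL-Probability.Probability"
begin

text \<open>Items are \<open>1, \<dots>, n\<close>, prices are \<open>p 1, \<dots>, p m\<close> and periods are \<open>1, \<dots>, T\<close>.
  A product \<open>(i, j)\<close> is item \<open>i\<close> offered at price \<open>p j\<close>.\<close>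

type_synonym product = "nat \<times> nat"
type_synonym assortment = "product set"

text \<open>Under integral demand, the outcome of the choice of customer \<open>t\<close> facing \<open>S\<close> is
  \<open>Some (i, j)\<close>, or \<open>None\<close> if nothing is chosen; the latter has the probability left over by
  \<open>\<Sum>(i,j)\<in>S. q t (i,j) S \<le> 1\<close>. Under fractional demand, the law of the demanded quantities is
  a probability measure on the product space of real vectors indexed by \<open>S\<close>.\<close>

datatype demand_model =
    Static_Integral "nat \<Rightarrow> assortment \<Rightarrow> product option pmf"
  | Dynamic_Integral "nat \<Rightarrow> assortment \<Rightarrow> product option pmf"
  | Static_Fractional "nat \<Rightarrow> assortment \<Rightarrow> (product \<Rightarrow> real) measure"

definition integral_demand ::
  "nat \<Rightarrow> assortment set \<Rightarrow> (nat \<Rightarrow> assortment \<Rightarrow> product option pmf) \<Rightarrow> bool" where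
  "integral_demand T \<S> C \<longleftrightarrow>
     (\<forall>t\<in>{1..T}. \<forall>S\<in>\<S>. set_pmf (C t S) \<subseteq> insert None (Some ` S))"

definition fractional_demand ::
  "nat \<Rightarrow> assortment set \<Rightarrow> (nat \<Rightarrow> assortment \<Rightarrow> (product \<Rightarrow> real) measure) \<Rightarrow> bool" where
  "fractional_demand T \<S> L \<longleftrightarrow>
     (\<forall>t\<in>{1..T}. \<forall>S\<in>\<S>.
        prob_space (L t S) \<and>
        sets (L t S) = sets (PiM S (\<lambda>_. borel)) \<and>
        (AE d in L t S. \<forall>s\<in>S. 0 \<le> d s \<and> d s \<le> 1) \<and>
        (AE d in L t S. \<forall>i j j'. (i, j) \<in> S \<and> (i, j') \<in> S \<and> j \<noteq> j' \<longrightarrow>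
           \<not> (0 < d (i, j) \<and> 0 < d (i, j'))))"

primrec valid_model ::
  "nat \<Rightarrow> nat \<Rightarrow> (nat \<Rightarrow> real) \<Rightarrow> assortment set \<Rightarrow> demand_model \<Rightarrow> bool" where
  "valid_model n T b \<S> (Static_Integral C) \<longleftrightarrow>
     (\<forall>i\<in>{1..n}. b i \<in> \<nat>) \<and> integral_demand T \<S> C"
| "valid_model n T b \<S> (Dynamic_Integral C) \<longleftrightarrow>
     (\<forall>i\<in>{1..n}. b i \<in> \<nat>) \<and> integral_demand T \<S> C"
| "valid_model n T b \<S> (Static_Fractional L) \<longleftrightarrow> fractional_demand T \<S> L"

text \<open>The rates \<open>q t (i,j) S\<close>; only their values for \<open>(i,j) \<in> S\<close> are ever used.\<close>

primrec rate :: "demand_model \<Rightarrow> nat \<Rightarrow> product \<Rightarrow> assortment \<Rightarrow> real" where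
  "rate (Static_Integral C) t s S = pmf (C t S) (Some s)"
| "rate (Dynamic_Integral C) t s S = pmf (C t S) (Some s)"
| "rate (Static_Fractional L) t s S = (\<integral>d. d s \<partial>L t S)"

definition substitutable ::
  "nat \<Rightarrow> assortment set \<Rightarrow> (nat \<Rightarrow> product \<Rightarrow> assortment \<Rightarrow> real) \<Rightarrow> bool" where
  "substitutable T \<S> q \<longleftrightarrow>
     (\<forall>t\<in>{1..T}. \<forall>S\<in>\<S>. \<forall>S'. S' \<subseteq> S \<longrightarrow> (\<forall>s\<in>S'. q t s S \<le> q t s S'))"

subsection \<open>Expected revenue when the assortments \<open>A 1, \<dots>, A T\<close> are offered\<close>

text \<open>Integral demand: \<open>integral_run V p b C A k\<close> is the joint law of the remaining inventories
  and the revenue collected after \<open>k\<close> periods, where a customer who is offered \<open>S\<close> when the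
  remaining inventories are \<open>R\<close> gets to see \<open>V R S\<close>.\<close>

fun purchase ::
  "(nat \<Rightarrow> real) \<Rightarrow> (nat \<Rightarrow> real) \<times> real \<Rightarrow> product option \<Rightarrow> (nat \<Rightarrow> real) \<times> real" where
  "purchase p (R, v) None = (R, v)"
| "purchase p (R, v) (Some (i, j)) =
     (if 0 < R i then (R(i := R i - 1), v + p j) else (R, v))"

primrec integral_run ::
  "((nat \<Rightarrow> real) \<Rightarrow> assortment \<Rightarrow> assortment) \<Rightarrow> (nat \<Rightarrow> real) \<Rightarrow> (nat \<Rightarrow> real) \<Rightarrow>
   (nat \<Rightarrow> assortment \<Rightarrow> product option pmf) \<Rightarrow> (nat \<Rightarrow> assortment) \<Rightarrow> nat \<Rightarrow>
   ((nat \<Rightarrow> real) \<times> real) pmf" where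
  "integral_run V p b C A 0 = return_pmf (b, 0)"
| "integral_run V p b C A (Suc k) =
     bind_pmf (integral_run V p b C A k)
       (\<lambda>(R, v). map_pmf (purchase p (R, v)) (C (Suc k) (V R (A (Suc k)))))"

definition sees_all :: "(nat \<Rightarrow> real) \<Rightarrow> assortment \<Rightarrow> assortment" where
  "sees_all R S = S"

definition sees_in_stock :: "(nat \<Rightarrow> real) \<Rightarrow> assortment \<Rightarrow> assortment" where
  "sees_in_stock R S = {(i, j) \<in> S. 0 < R i}"

text \<open>Fractional demand: \<open>d t (i, j)\<close> is the quantity of \<open>(i, j)\<close> demanded in period \<open>t\<close>, and
  \<open>fractional_stock b A d k i\<close> is the inventory of item \<open>i\<close> remaining after \<open>k\<close> periods.\<close>

primrec fractional_stock ::
  "(nat \<Rightarrow> real) \<Rightarrow> (nat \<Rightarrow> assortment) \<Rightarrow> (nat \<Rightarrow> product \<Rightarrow> real) \<Rightarrow> nat \<Rightarrow> nat \<Rightarrow> real" where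
  "fractional_stock b A d 0 i = b i"
| "fractional_stock b A d (Suc k) i =
     fractional_stock b A d k i -
       (\<Sum>j | (i, j) \<in> A (Suc k). min (d (Suc k) (i, j)) (fractional_stock b A d k i))"

definition fractional_revenue ::
  "nat \<Rightarrow> (nat \<Rightarrow> real) \<Rightarrow> (nat \<Rightarrow> real) \<Rightarrow> (nat \<Rightarrow> assortment) \<Rightarrow>
   (nat \<Rightarrow> product \<Rightarrow> real) \<Rightarrow> real" where
  "fractional_revenue T p b A d =
     (\<Sum>t=1..T. \<Sum>(i, j)\<in>A t. p j * min (d t (i, j)) (fractional_stock b A d (t - 1) i))"

primrec expected_revenue ::
  "nat \<Rightarrow> (nat \<Rightarrow> real) \<Rightarrow> (nat \<Rightarrow> real) \<Rightarrow> demand_model \<Rightarrow> (nat \<Rightarrow> assortment) \<Rightarrow> real" where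
  "expected_revenue T p b (Static_Integral C) A =
     measure_pmf.expectation (integral_run sees_all p b C A T) snd"
| "expected_revenue T p b (Dynamic_Integral C) A =
     measure_pmf.expectation (integral_run sees_in_stock p b C A T) snd"
| "expected_revenue T p b (Static_Fractional L) A =
     (\<integral>d. fractional_revenue T p b A d \<partial>PiM {1..T} (\<lambda>t. L t (A t)))"

subsection \<open>The linear program\<close>

definition cdlp_feasible ::
  "nat \<Rightarrow> nat \<Rightarrow> (nat \<Rightarrow> real) \<Rightarrow> assortment set \<Rightarrow>
   (nat \<Rightarrow> product \<Rightarrow> assortment \<Rightarrow> real) \<Rightarrow> (nat \<Rightarrow> assortment \<Rightarrow> real) \<Rightarrow> bool" where
  "cdlp_feasible n T b \<S> q x \<longleftrightarrow>
     (\<forall>i\<in>{1..n}. (\<Sum>t=1..T. \<Sum>S\<in>\<S>. x t S * (\<Sum>j | (i, j) \<in> S. q t (i, j) S)) \<le> b i) \<and>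
     (\<forall>t\<in>{1..T}. (\<Sum>S\<in>\<S>. x t S) = 1) \<and>
     (\<forall>t\<in>{1..T}. \<forall>S\<in>\<S>. 0 \<le> x t S)"

definition cdlp_objective ::
  "nat \<Rightarrow> (nat \<Rightarrow> real) \<Rightarrow> assortment set \<Rightarrow>
   (nat \<Rightarrow> product \<Rightarrow> assortment \<Rightarrow> real) \<Rightarrow> (nat \<Rightarrow> assortment \<Rightarrow> real) \<Rightarrow> real" where
  "cdlp_objective T p \<S> q x =
     (\<Sum>t=1..T. \<Sum>S\<in>\<S>. x t S * (\<Sum>(i, j)\<in>S. p j * q t (i, j) S))"

definition cdlp_optimal ::
  "nat \<Rightarrow> nat \<Rightarrow> (nat \<Rightarrow> real) \<Rightarrow> (nat \<Rightarrow> real) \<Rightarrow> assortment set \<Rightarrow>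
   (nat \<Rightarrow> product \<Rightarrow> assortment \<Rightarrow> real) \<Rightarrow> (nat \<Rightarrow> assortment \<Rightarrow> real) \<Rightarrow> bool" where
  "cdlp_optimal n T p b \<S> q x \<longleftrightarrow>
     cdlp_feasible n T b \<S> q x \<and>
     (\<forall>y. cdlp_feasible n T b \<S> q y \<longrightarrow> cdlp_objective T p \<S> q y \<le> cdlp_objective T p \<S> q x)"

definition OPT_LP ::
  "nat \<Rightarrow> nat \<Rightarrow> (nat \<Rightarrow> real) \<Rightarrow> (nat \<Rightarrow> real) \<Rightarrow> assortment set \<Rightarrow>
   (nat \<Rightarrow> product \<Rightarrow> assortment \<Rightarrow> real) \<Rightarrow> real" where
  "OPT_LP n T p b \<S> q = (SUP x \<in> {x. cdlp_feasible n T b \<S> q x}. cdlp_objective T p \<S> q x)"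

subsection \<open>The algorithm\<close>

definition item_revenue ::
  "nat \<Rightarrow> (nat \<Rightarrow> real) \<Rightarrow> assortment set \<Rightarrow>
   (nat \<Rightarrow> product \<Rightarrow> assortment \<Rightarrow> real) \<Rightarrow> (nat \<Rightarrow> assortment \<Rightarrow> real) \<Rightarrow> nat \<Rightarrow> real" where
  "item_revenue T p \<S> q x i =
     (\<Sum>t=1..T. \<Sum>S\<in>\<S>. x t S * (\<Sum>j | (i, j) \<in> S. p j * q t (i, j) S))"

definition draw :: "assortment set \<Rightarrow> (assortment \<Rightarrow> real) \<Rightarrow> assortment pmf" where
  "draw \<S> w = embed_pmf (\<lambda>S. if S \<in> \<S> then w S else 0)"

text \<open>The law of the sequence of offered assortments, given a solution \<open>x\<close> of the linear
  program. Entries at indices outside \<open>{1..T}\<close> are irrelevant.\<close>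

definition algorithm2 ::
  "nat \<Rightarrow> (nat \<Rightarrow> real) \<Rightarrow> (nat \<Rightarrow> real) \<Rightarrow> assortment set \<Rightarrow>
   (nat \<Rightarrow> product \<Rightarrow> assortment \<Rightarrow> real) \<Rightarrow> (nat \<Rightarrow> assortment \<Rightarrow> real) \<Rightarrow>
   (nat \<Rightarrow> assortment) pmf" where
  "algorithm2 T p b \<S> q x =
     map_pmf (\<lambda>S t. {(i, j) \<in> S t. p j > item_revenue T p \<S> q x i / (2 * b i)})
       (Pi_pmf {1..T} {} (\<lambda>t. draw \<S> (x t)))"

end

theory Submission
  imports Defs
begin

text \<open>Put \<open>\<theta> i = r i / (2 * b i)\<close>. When the stock of item \<open>i\<close> is \<open>R \<le> b i\<close>, any demand for it is
  met at least in the proportion \<open>R / b i\<close>. Splitting each price as \<open>\<theta> i + (p j - \<theta> i)\<close>, the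
  first part earns exactly \<open>\<theta> i\<close> per unit of depleted stock, hence \<open>\<theta> i * (b i - R\<^sub>T)\<close> in total,
  and the second one earns in each period at least \<open>R / b i\<close> times the expected surplus over
  \<open>\<theta> i\<close>. Assortments are drawn independently, so \<open>R\<close> and the surplus offered next are
  independent, and \<open>R\<close> only decreases; hence the second part is at least \<open>E R\<^sub>T / b i\<close> times the
  total surplus. By substitutability and the capacity constraint, that total is at least
  \<open>r i - \<theta> i * b i = \<theta> i * b i\<close>. The two parts add up to at least \<open>\<theta> i * b i = r i / 2\<close>,
  whatever \<open>E R\<^sub>T\<close> is.\<close>

subsection \<open>Expectations over independent choices\<close>


text \<open>Finite supports make every real function integrable, so \<open>h\<close> may be
  arbitrary. This is what unfolds \<open>integral_run\<close> by one period.\<close>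

lemma expectation_bind_finite:
  fixes h :: "'b \<Rightarrow> real"
  assumes "finite (set_pmf P)" "\<And>x. x \<in> set_pmf P \<Longrightarrow> finite (set_pmf (f x))"
  shows "measure_pmf.expectation (bind_pmf P f) h =
    measure_pmf.expectation P (\<lambda>x. measure_pmf.expectation (f x) h)"
  using assms
  by (subst pmf_expectation_bind[of "set_pmf P"], simp_all)
    (subst integral_measure_pmf[of "set_pmf P"], simp_all)

lemma expectation_pair_prod:
  fixes g :: "'a \<Rightarrow> real" and h :: "'b \<Rightarrow> real"
  assumes "finite (set_pmf P)" "finite (set_pmf Q)"
  shows "measure_pmf.expectation (pair_pmf P Q) (\<lambda>(x, y). g x * h y) =
    measure_pmf.expectation P g * measure_pmf.expectation Q h"
proof -
  have "measure_pmf.expectation (pair_pmf P Q) (\<lambda>(x, y). g x * h y) =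
      (\<Sum>(x, y)\<in>set_pmf P \<times> set_pmf Q. (pmf P x * g x) * (pmf Q y * h y))"
    using assms
    by (subst integral_measure_pmf[of "set_pmf P \<times> set_pmf Q"])
      (auto simp: pmf_pair intro!: sum.cong)
  also have "\<dots> = (\<Sum>x\<in>set_pmf P. pmf P x * g x) * (\<Sum>y\<in>set_pmf Q. pmf Q y * h y)"
    by (simp add: sum_product sum.cartesian_product)
  also have "\<dots> = measure_pmf.expectation P g * measure_pmf.expectation Q h"
    using assms
    by (simp add: integral_measure_pmf[of "set_pmf P"] integral_measure_pmf[of "set_pmf Q"])
  finally show ?thesis .
qed

lemma finite_set_Pi_pmf:
  assumes "finite I" "\<And>t. t \<in> I \<Longrightarrow> finite (set_pmf (\<mu> t))"
  shows "finite (set_pmf (Pi_pmf I dflt \<mu>))"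
  using assms by (simp add: set_Pi_pmf finite_PiE_dflt)

text \<open>Independence of one coordinate from the others. Invariance under updates at
  \<open>i\<close> expresses that \<open>g\<close> ignores that coordinate, so \<open>g\<close> can
  be averaged under the law on \<open>I\<close> alone.\<close>

lemma expectation_Pi_pmf_insert:
  fixes g :: "('i \<Rightarrow> 'a) \<Rightarrow> real" and h :: "'a \<Rightarrow> real"
  assumes "finite I" "i \<notin> I" "\<And>t. t \<in> insert i I \<Longrightarrow> finite (set_pmf (\<mu> t))"
    and "\<And>A S. g (A(i := S)) = g A"
  shows "measure_pmf.expectation (Pi_pmf (insert i I) dflt \<mu>) (\<lambda>A. g A * h (A i)) =
    measure_pmf.expectation (Pi_pmf I dflt \<mu>) g * measure_pmf.expectation (\<mu> i) h"
proof -
  have "measure_pmf.expectation (Pi_pmf (insert i I) dflt \<mu>) (\<lambda>A. g A * h (A i)) =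
      measure_pmf.expectation (pair_pmf (\<mu> i) (Pi_pmf I dflt \<mu>)) (\<lambda>(S, A). h S * g A)"
    using assms(1,2,4) by (simp add: Pi_pmf_insert case_prod_unfold mult.commute)
  also have "\<dots> = measure_pmf.expectation (\<mu> i) h * measure_pmf.expectation (Pi_pmf I dflt \<mu>) g"
    using assms by (intro expectation_pair_prod finite_set_Pi_pmf) auto
  finally show ?thesis by (simp add: mult.commute)
qed

text \<open>The core argument, stripped of the demand model. \<open>V k A\<close> and
  \<open>R k i A\<close> stand for the expected revenue and stock after \<open>k\<close> periods
  under the fixed offers \<open>A\<close>, and \<open>w t i S\<close> for the surplus of item
  \<open>i\<close> when \<open>S\<close> is offered in period \<open>t\<close>. The assumptions
  \<open>V_past\<close> and \<open>R_past\<close> let the draw of period \<open>Suc k\<close> be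
  averaged separately.\<close>

lemma independent_offers_bound:
  fixes V :: "nat \<Rightarrow> (nat \<Rightarrow> 'a) \<Rightarrow> real" and R :: "nat \<Rightarrow> 'i \<Rightarrow> (nat \<Rightarrow> 'a) \<Rightarrow> real"
    and w :: "nat \<Rightarrow> 'i \<Rightarrow> 'a \<Rightarrow> real" and b \<theta> :: "'i \<Rightarrow> real"
  assumes G: "finite G" "\<And>t. t \<in> {1..T} \<Longrightarrow> set_pmf (\<mu> t) \<subseteq> G"
    and "finite I"
    and V0: "\<And>A. V 0 A = 0" and R0: "\<And>i A. i \<in> I \<Longrightarrow> R 0 i A = b i"
    and V_past: "\<And>k A S. V k (A(Suc k := S)) = V k A"
    and R_past: "\<And>k i A S. R k i (A(Suc k := S)) = R k i A"
    and step: "\<And>k A. k < T \<Longrightarrow> A \<in> {1..Suc k} \<rightarrow> G \<Longrightarrow>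
      V k A + (\<Sum>i\<in>I. \<theta> i * (R k i A - R (Suc k) i A) + R k i A / b i * w (Suc k) i (A (Suc k)))
        \<le> V (Suc k) A"
    and R_mono: "\<And>k A i. k < T \<Longrightarrow> A \<in> {1..Suc k} \<rightarrow> G \<Longrightarrow> i \<in> I \<Longrightarrow> R (Suc k) i A \<le> R k i A"
    and R_nonneg: "\<And>A i. A \<in> {1..T} \<rightarrow> G \<Longrightarrow> i \<in> I \<Longrightarrow> 0 \<le> R T i A"
    and w_nonneg: "\<And>t i S. t \<in> {1..T} \<Longrightarrow> i \<in> I \<Longrightarrow> S \<in> G \<Longrightarrow> 0 \<le> w t i S"
    and b_pos: "\<And>i. i \<in> I \<Longrightarrow> 0 < b i"
    and w_total: "\<And>i. i \<in> I \<Longrightarrow>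
      \<theta> i * b i \<le> (\<Sum>t=1..T. measure_pmf.expectation (\<mu> t) (w t i))"
  shows "(\<Sum>i\<in>I. \<theta> i * b i) \<le> measure_pmf.expectation (Pi_pmf {1..T} dflt \<mu>) (V T)"
proof -
  define P where "P k = Pi_pmf {1..k} dflt \<mu>" for k
  define W where "W t i = measure_pmf.expectation (\<mu> t) (w t i)" for t i
  define ER where "ER k i = measure_pmf.expectation (P k) (R k i)" for k i
  have fin_\<mu>: "finite (set_pmf (\<mu> t))" if "t \<in> {1..T}" for t
    using G that finite_subset by blast
  have fin_P: "finite (set_pmf (P k))" if "k \<le> T" for k
    unfolding P_def using that by (intro finite_set_Pi_pmf fin_\<mu>) auto
  have set_P: "A \<in> {1..k} \<rightarrow> G" if "k \<le> T" "A \<in> set_pmf (P k)" for k A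
    using that G(2) unfolding P_def set_Pi_pmf[OF finite_atLeastAtMost]
    by (fastforce simp: PiE_dflt_def)
  have P_Suc: "measure_pmf.expectation (P (Suc k)) (\<lambda>A. g A * h (A (Suc k))) =
      measure_pmf.expectation (P k) g * measure_pmf.expectation (\<mu> (Suc k)) h"
    if "k < T" "\<And>A S. g (A(Suc k := S)) = g A" for k g and h :: "'a \<Rightarrow> real"
    unfolding P_def using that fin_\<mu>
    by (subst atLeastAtMostSuc_conv) (auto intro!: expectation_Pi_pmf_insert)
  have P_Suc': "measure_pmf.expectation (P (Suc k)) g = measure_pmf.expectation (P k) g"
    if "k < T" "\<And>A S. g (A(Suc k := S)) = g A" for k and g :: "(nat \<Rightarrow> 'a) \<Rightarrow> real"
    using P_Suc[OF that, of "\<lambda>_. 1"] by simp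
  have int: "integrable (P k) f" if "k \<le> T" for k and f :: "_ \<Rightarrow> real"
    using fin_P[OF that] by (rule integrable_measure_pmf_finite)
  have W_nonneg: "0 \<le> W t i" if "t \<in> {1..T}" "i \<in> I" for t i
    unfolding W_def using G(2)[OF that(1)] w_nonneg[OF that]
    by (intro integral_nonneg_AE) (auto simp: AE_measure_pmf_iff)
  have ER_mono: "ER (Suc k) i \<le> ER k i" if "k < T" "i \<in> I" for k i
  proof -
    have "ER (Suc k) i \<le> measure_pmf.expectation (P (Suc k)) (R k i)"
      unfolding ER_def using that R_mono set_P[of "Suc k"]
      by (intro integral_mono_AE int) (auto simp: AE_measure_pmf_iff)
    also have "\<dots> = ER k i"
      unfolding ER_def using that by (intro P_Suc') (auto simp: R_past)
    finally show ?thesis .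
  qed
  \<comment> \<open>The whole surplus accumulated up to period \<open>k\<close> is weighted by the
    current stock \<open>ER k\<close>, not by the stock at the time it was offered. This form can be
    propagated by induction because \<open>ER\<close> decreases.\<close>
  have bound: "(\<Sum>i\<in>I. \<theta> i * (b i - ER k i) + ER k i / b i * (\<Sum>t=1..k. W t i))
      \<le> measure_pmf.expectation (P k) (V k)" if "k \<le> T" for k
    using that
  proof (induction k)
    case 0
    then show ?case by (simp add: ER_def P_def V0 R0)
  next
    case (Suc k)
    then have k: "k < T" by simp
    \<comment> \<open>As \<open>W\<close> is nonnegative, the larger weight \<open>ER k\<close> only
      increases the surplus part. The \<theta> part keeps \<open>ER (Suc k)\<close>, so that it
      telescopes exactly.\<close>
    have "(\<Sum>i\<in>I. \<theta> i * (b i - ER (Suc k) i) + ER (Suc k) i / b i * (\<Sum>t=1..Suc k. W t i))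
        \<le> (\<Sum>i\<in>I. \<theta> i * (b i - ER (Suc k) i) + ER k i / b i * (\<Sum>t=1..Suc k. W t i))"
      using k b_pos ER_mono W_nonneg
      by (intro sum_mono add_left_mono mult_right_mono divide_right_mono sum_nonneg)
        (auto intro: less_imp_le)
    also have "\<dots> = (\<Sum>i\<in>I. \<theta> i * (b i - ER k i) + ER k i / b i * (\<Sum>t=1..k. W t i)) +
        (\<Sum>i\<in>I. \<theta> i * (ER k i - ER (Suc k) i) + ER k i / b i * W (Suc k) i)"
      by (simp add: sum.distrib[symmetric] algebra_simps)
    also have "\<dots> \<le> measure_pmf.expectation (P k) (V k) +
        (\<Sum>i\<in>I. \<theta> i * (ER k i - ER (Suc k) i) + ER k i / b i * W (Suc k) i)"
      using Suc by simp
    \<comment> \<open>\<open>R k\<close> depends on earlier draws only, so its product with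
      \<open>w\<close> at the new draw factorises. The division by \<open>b i\<close> comes last to
      expose that product to \<open>P_Suc\<close>.\<close>
    also have "\<dots> = measure_pmf.expectation (P (Suc k)) (\<lambda>A. V k A +
        (\<Sum>i\<in>I. \<theta> i * (R k i A - R (Suc k) i A) + R k i A * w (Suc k) i (A (Suc k)) / b i))"
      using k Suc.prems
      by (simp add: int P_Suc P_Suc' V_past R_past ER_def W_def)
    also have "\<dots> \<le> measure_pmf.expectation (P (Suc k)) (V (Suc k))"
      using Suc.prems step[OF k] set_P[OF Suc.prems]
      by (intro integral_mono_AE int) (auto simp: AE_measure_pmf_iff)
    finally show ?case .
  qed
  have "(\<Sum>i\<in>I. \<theta> i * b i) \<le> (\<Sum>i\<in>I. \<theta> i * (b i - ER T i) + ER T i / b i * (\<Sum>t=1..T. W t i))"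
  proof (rule sum_mono)
    fix i assume i: "i \<in> I"
    have "0 \<le> ER T i"
      unfolding ER_def using R_nonneg set_P[of T] i
      by (intro integral_nonneg_AE) (auto simp: AE_measure_pmf_iff)
    \<comment> \<open>Scaling \<open>w_total\<close> by \<open>ER T i / b i\<close> gives a surplus
      part of at least \<open>\<theta> i * ER T i\<close>, which cancels the stock left over in the
      first part.\<close>
    then have "ER T i / b i * (\<theta> i * b i) \<le> ER T i / b i * (\<Sum>t=1..T. W t i)"
      using w_total[OF i] b_pos[OF i] unfolding W_def by (intro mult_left_mono) auto
    then show "\<theta> i * b i \<le> \<theta> i * (b i - ER T i) + ER T i / b i * (\<Sum>t=1..T. W t i)"
      using b_pos[OF i] by (simp add: algebra_simps)
  qed
  also have "\<dots> \<le> measure_pmf.expectation (P T) (V T)"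
    by (rule bound) simp
  finally show ?thesis unfolding P_def .
qed


text \<open>Passes from sums over products, as in revenues, to sums over items, as in capacities and
  stocks. Items absent from \<open>S\<close> contribute an empty sum.\<close>

lemma sum_by_fst:
  fixes f :: "'a \<Rightarrow> 'b \<Rightarrow> 'c::comm_monoid_add"
  assumes "finite S" "fst ` S \<subseteq> I" "finite I"
  shows "(\<Sum>(i, j)\<in>S. f i j) = (\<Sum>i\<in>I. \<Sum>j | (i, j) \<in> S. f i j)"
proof -
  have fin: "finite {j. (i, j) \<in> S}" for i
    by (rule finite_subset[of _ "snd ` S"]) (use assms(1) in force)+
  have "S = (SIGMA i:I. {j. (i, j) \<in> S})"
    using assms(2) by force
  then show ?thesis
    using sum.Sigma[of I "\<lambda>i. {j. (i, j) \<in> S}" f] assms(3) fin by simp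
qed

subsection \<open>Offering only products priced above the thresholds\<close>

text \<open>The situation after cheap products have been discarded: \<open>\<G>\<close> contains the
  possible offers and \<open>\<mu> t\<close> is the law of the offer in period \<open>t\<close>. The
  capacity constraints and the choice of \<theta> enter through \<open>surplus_total\<close>.
  Closure under subsets covers the part of an offer that a customer actually sees.\<close>

locale price_threshold =
  fixes n T :: nat and p b \<theta> :: "nat \<Rightarrow> real" and \<G> :: "assortment set"
    and q :: "nat \<Rightarrow> product \<Rightarrow> assortment \<Rightarrow> real" and \<mu> :: "nat \<Rightarrow> assortment pmf"
  assumes finite_assortments: "finite \<G>"
    and finite_assortment: "S \<in> \<G> \<Longrightarrow> finite S"
    and items: "S \<in> \<G> \<Longrightarrow> fst ` S \<subseteq> {1..n}"
    and above_threshold: "S \<in> \<G> \<Longrightarrow> (i, j) \<in> S \<Longrightarrow> \<theta> i < p j"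
    and subset_closed: "S \<in> \<G> \<Longrightarrow> S' \<subseteq> S \<Longrightarrow> S' \<in> \<G>"
    and stock_ge_1: "i \<in> {1..n} \<Longrightarrow> 1 \<le> b i"
    and substitutability: "substitutable T \<G> q"
    and rate_nonneg: "t \<in> {1..T} \<Longrightarrow> S \<in> \<G> \<Longrightarrow> s \<in> S \<Longrightarrow> 0 \<le> q t s S"
    and offered: "t \<in> {1..T} \<Longrightarrow> set_pmf (\<mu> t) \<subseteq> \<G>"
    and surplus_total: "i \<in> {1..n} \<Longrightarrow> \<theta> i * b i \<le> (\<Sum>t=1..T.
      measure_pmf.expectation (\<mu> t) (\<lambda>S. \<Sum>j | (i, j) \<in> S. (p j - \<theta> i) * q t (i, j) S))"
begin

text \<open>The expected value above the threshold that is demanded of item \<open>i\<close>, as if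
  its stock were unlimited.\<close>

definition surplus :: "nat \<Rightarrow> nat \<Rightarrow> assortment \<Rightarrow> real" where
  "surplus t i S = (\<Sum>j | (i, j) \<in> S. (p j - \<theta> i) * q t (i, j) S)"

lemma sum_items:
  assumes "S \<in> \<G>"
  shows "(\<Sum>(i, j)\<in>S. f i j) = (\<Sum>i=1..n. \<Sum>j | (i, j) \<in> S. f i j)"
  using assms finite_assortment items by (intro sum_by_fst) auto

lemma surplus_nonneg:
  assumes "t \<in> {1..T}" "S \<in> \<G>"
  shows "0 \<le> surplus t i S"
  unfolding surplus_def using assms above_threshold rate_nonneg
  by (intro sum_nonneg mult_nonneg_nonneg) (auto simp: less_imp_le)

lemma sum_surplus:
  assumes "S \<in> \<G>"
  shows "(\<Sum>i=1..n. c i * surplus t i S) = (\<Sum>(i, j)\<in>S. (p j - \<theta> i) * (c i * q t (i, j) S))"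
  by (simp add: sum_items[OF assms] surplus_def sum_distrib_left algebra_simps)

text \<open>The abstract bound with \<open>surplus\<close> as \<open>w\<close>. A demand model then
  has to supply only its revenue and stock processes and the one-period inequality.\<close>

lemma revenue_bound:
  fixes V :: "nat \<Rightarrow> (nat \<Rightarrow> assortment) \<Rightarrow> real"
    and R :: "nat \<Rightarrow> nat \<Rightarrow> (nat \<Rightarrow> assortment) \<Rightarrow> real"
  assumes "\<And>A. V 0 A = 0" "\<And>i A. i \<in> {1..n} \<Longrightarrow> R 0 i A = b i"
    and "\<And>k A S. V k (A(Suc k := S)) = V k A"
    and "\<And>k i A S. R k i (A(Suc k := S)) = R k i A"
    and "\<And>k A. k < T \<Longrightarrow> A \<in> {1..Suc k} \<rightarrow> \<G> \<Longrightarrow>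
      V k A + (\<Sum>i=1..n. \<theta> i * (R k i A - R (Suc k) i A) + R k i A / b i * surplus (Suc k) i (A (Suc k)))
        \<le> V (Suc k) A"
    and "\<And>k A i. k < T \<Longrightarrow> A \<in> {1..Suc k} \<rightarrow> \<G> \<Longrightarrow> i \<in> {1..n} \<Longrightarrow> R (Suc k) i A \<le> R k i A"
    and "\<And>A i. A \<in> {1..T} \<rightarrow> \<G> \<Longrightarrow> i \<in> {1..n} \<Longrightarrow> 0 \<le> R T i A"
  shows "(\<Sum>i=1..n. \<theta> i * b i) \<le> measure_pmf.expectation (Pi_pmf {1..T} dflt \<mu>) (V T)"
proof (rule independent_offers_bound[where G = \<G> and R = R and w = surplus])
  show "0 < b i" if "i \<in> {1..n}" for i
    using stock_ge_1[OF that] by simp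
  show "\<theta> i * b i \<le> (\<Sum>t=1..T. measure_pmf.expectation (\<mu> t) (surplus t i))"
    if "i \<in> {1..n}" for i
    using surplus_total[OF that] unfolding surplus_def[abs_def] .
qed ((rule assms finite_assortments offered surplus_nonneg; assumption) | simp)+

subsection \<open>Integral demand\<close>

text \<open>The price splitting for a single customer: a sale of \<open>(i, j)\<close> books
  \<open>\<theta> i\<close> through the unit of stock lost and \<open>p j - \<theta> i\<close>
  through the indicator. Indicators are used because their expectations are the choice
  probabilities.\<close>

lemma purchase_gain:
  assumes S: "S \<in> \<G>" and c: "c \<in> insert None (Some ` S)"
  shows "snd (purchase p (R, v) c) =
    v + (\<Sum>i=1..n. \<theta> i * (R i - fst (purchase p (R, v) c) i)) +
    (\<Sum>s\<in>S. (p (snd s) - \<theta> (fst s)) * (if 0 < R (fst s) then indicator {Some s} c else 0))"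
proof (cases c)
  case None
  then show ?thesis by (auto intro!: sum.neutral)
next
  case (Some s)
  obtain i j where s: "s = (i, j)" by force
  have ij: "(i, j) \<in> S" using c Some s by auto
  then have i: "i \<in> {1..n}" using items[OF S] by force
  have "(\<Sum>s\<in>S. (p (snd s) - \<theta> (fst s)) * (if 0 < R (fst s) then indicator {Some s} c else 0)) =
      (\<Sum>s\<in>S. if s = (i, j) then (if 0 < R i then p j - \<theta> i else 0) else 0)"
    by (intro sum.cong) (auto simp: Some s indicator_def)
  also have "\<dots> = (if 0 < R i then p j - \<theta> i else 0)"
    using ij finite_assortment[OF S] by simp
  moreover have "(\<Sum>i'=1..n. \<theta> i' * (R i' - fst (purchase p (R, v) c) i')) =
      (\<Sum>i'=1..n. if i' = i then (if 0 < R i then \<theta> i else 0) else 0)"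
    by (intro sum.cong) (auto simp: Some s)
  moreover have "\<dots> = (if 0 < R i then \<theta> i else 0)"
    using i by simp
  ultimately show ?thesis by (simp add: Some s)
qed

section \<open>Dependence on the past and range of the stocks under integral demand\<close>

lemma integral_run_cong:
  assumes "\<And>t. t \<in> {1..k} \<Longrightarrow> A' t = A t"
  shows "integral_run view p b C A' k = integral_run view p b C A k"
  using assms
proof (induction k)
  case (Suc k)
  have "integral_run view p b C A' k = integral_run view p b C A k"
    by (rule Suc.IH, rule Suc.prems) simp
  moreover have "A' (Suc k) = A (Suc k)"
    by (rule Suc.prems) simp
  ultimately show ?case by (simp only: integral_run.simps)
qed simp

lemma integral_run_past:
  "integral_run view p b C (A(Suc k := S)) k = integral_run view p b C A k"
  by (rule integral_run_cong) simp

text \<open>A sale removes one unit and happens only at positive stock, so integral stocks stay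
  natural numbers. Membership in \<open>\<nat>\<close> gives nonnegativity and also that a stock
  which is not positive is zero.\<close>

lemma integral_run_support:
  assumes C: "integral_demand T \<G> C" and b: "\<forall>i\<in>{1..n}. b i \<in> \<nat>"
    and view: "\<And>R S. view R S \<subseteq> S"
    and "k \<le> T" "A \<in> {1..k} \<rightarrow> \<G>"
  shows "finite (set_pmf (integral_run view p b C A k)) \<and>
    (\<forall>(R, v)\<in>set_pmf (integral_run view p b C A k). \<forall>i\<in>{1..n}. R i \<in> \<nat> \<and> R i \<le> b i)"
  using assms(4,5)
proof (induction k)
  case 0
  then show ?case using b by simp
next
  case (Suc k)
  have IH: "finite (set_pmf (integral_run view p b C A k))"
      "\<forall>(R, v)\<in>set_pmf (integral_run view p b C A k). \<forall>i\<in>{1..n}. R i \<in> \<nat> \<and> R i \<le> b i"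
    using Suc by (simp_all add: Pi_iff)
  have S: "A (Suc k) \<in> \<G>" using Suc.prems by auto
  have "view R (A (Suc k)) \<in> \<G>" for R
    using S view by (rule subset_closed)
  moreover from this have "finite (set_pmf (C (Suc k) (view R (A (Suc k)))))" for R
    using C Suc.prems finite_assortment finite_subset unfolding integral_demand_def
    by (metis Suc_leI atLeastAtMost_iff finite_imageI finite_insert le_add1 plus_1_eq_Suc)
  moreover have "fst (purchase p s c) i \<in> \<nat> \<and> fst (purchase p s c) i \<le> b i"
    if s: "fst s i \<in> \<nat>" "fst s i \<le> b i" for s c i
  proof -
    obtain R v where [simp]: "s = (R, v)" by force
    note R = s[simplified]
    obtain l where l: "R i = of_nat l" using R(1) by (auto elim: Nats_cases)
    have "R i - 1 \<in> \<nat>" if "0 < R i"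
    proof -
      \<comment> \<open>Truncated subtraction is harmless here: positive stock means
        \<open>l\<close> is at least 1.\<close>
      have "R i - 1 = of_nat (l - 1)" using that l by (simp add: of_nat_diff)
      then show ?thesis by simp
    qed
    then show ?thesis
      using R by (cases "(p, (R, v), c)" rule: purchase.cases) auto
  qed
  ultimately show ?case
    using IH by (simp add: split_beta)
qed

text \<open>Static and dynamic substitution are treated at once: in both, the customer sees a subset
  of the offer that retains every product in stock, and this is all that is asked of
  \<open>view\<close>.\<close>

lemma integral_revenue_bound:
  assumes q: "q = (\<lambda>t s S. pmf (C t S) (Some s))"
    and C: "integral_demand T \<G> C" and b: "\<forall>i\<in>{1..n}. b i \<in> \<nat>"
    and view: "\<And>R S. view R S \<subseteq> S"
    and view_in_stock: "\<And>R S i j. (i, j) \<in> S \<Longrightarrow> 0 < R i \<Longrightarrow> (i, j) \<in> view R S"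
  shows "(\<Sum>i=1..n. \<theta> i * b i) \<le> measure_pmf.expectation (Pi_pmf {1..T} dflt \<mu>)
    (\<lambda>A. measure_pmf.expectation (integral_run view p b C A T) snd)"
proof -
  define run where "run A k = integral_run view p b C A k" for A k
  define V where "V k A = measure_pmf.expectation (run A k) snd" for k A
  define R where "R k i A = measure_pmf.expectation (run A k) (\<lambda>s. fst s i)" for k i A
  have supp: "finite (set_pmf (run A k))"
      "\<And>r v i. (r, v) \<in> set_pmf (run A k) \<Longrightarrow> i \<in> {1..n} \<Longrightarrow> r i \<in> \<nat> \<and> r i \<le> b i"
    if "k \<le> T" "A \<in> {1..k} \<rightarrow> \<G>" for k A
    using integral_run_support[where view = view, OF C b view that] by (auto simp: run_def)
  show ?thesis
    unfolding run_def[symmetric] V_def[symmetric]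
  proof (rule revenue_bound[where R = R])
    fix k A assume k: "k < T" and A: "A \<in> {1..Suc k} \<rightarrow> \<G>"
    define S where "S = A (Suc k)"
    define c where "c r = C (Suc k) (view r S)" for r
    have A': "A \<in> {1..k} \<rightarrow> \<G>" using A by (auto simp: Pi_iff)
    have S: "S \<in> \<G>" using A by (auto simp: S_def)
    have view_S: "view r S \<in> \<G>" for r using S view by (rule subset_closed)
    have set_c: "set_pmf (c r) \<subseteq> insert None (Some ` view r S)" for r
      using C view_S k by (auto simp: integral_demand_def c_def)
    then have fin_c: "finite (set_pmf (c r))" for r
      using finite_assortment[OF view_S] by (meson finite_imageI finite_insert finite_subset)
    note fin = supp(1)[OF less_imp_le[OF k] A']
    note int = integrable_measure_pmf_finite[OF fin]
    note int_c = integrable_measure_pmf_finite[OF fin_c]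
    have E_Suc: "measure_pmf.expectation (run A (Suc k)) f = measure_pmf.expectation (run A k)
        (\<lambda>s. measure_pmf.expectation (c (fst s)) (\<lambda>y. f (purchase p s y)))" for f :: "_ \<Rightarrow> real"
      unfolding run_def
      using fin fin_c by (simp add: expectation_bind_finite run_def c_def S_def split_beta)
    show "R (Suc k) i A \<le> R k i A" for i
    proof -
      have "fst (purchase p s y) i \<le> fst s i" for s y
        by (cases s; cases y) auto
      then have "measure_pmf.expectation (c (fst s)) (\<lambda>y. fst (purchase p s y) i) \<le> fst s i" for s
        using integral_mono[OF int_c[where f = "\<lambda>y. fst (purchase p s y) i"] int_c[where f = "\<lambda>_. fst s i"]] by simp
      then show ?thesis
        unfolding R_def E_Suc by (intro integral_mono int)
    qed
    \<comment> \<open>The one-period inequality is first shown conditionally on each reachable state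
      \<open>(r, v)\<close>, where the seen assortment is a fixed set.\<close>
    have step: "v + (\<Sum>i=1..n. \<theta> i * (r i -
          measure_pmf.expectation (c r) (\<lambda>y. fst (purchase p (r, v) y) i)) +
          r i / b i * surplus (Suc k) i S)
        \<le> measure_pmf.expectation (c r) (\<lambda>y. snd (purchase p (r, v) y))"
      if rv: "(r, v) \<in> set_pmf (run A k)" for r v
    proof -
      have r: "r i \<in> \<nat>" "r i \<le> b i" if "i \<in> {1..n}" for i
        using supp(2)[OF _ A' rv that] k by auto
      have "(\<Sum>i=1..n. r i / b i * surplus (Suc k) i S) =
          (\<Sum>(i, j)\<in>S. (p j - \<theta> i) * (r i / b i * q (Suc k) (i, j) S))"
        by (rule sum_surplus[OF S])
      \<comment> \<open>An offered product that is not seen is out of stock, and its weight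
        \<open>r i / b i\<close> is zero.\<close>
      also have "\<dots> = (\<Sum>(i, j)\<in>view r S. (p j - \<theta> i) * (r i / b i * q (Suc k) (i, j) S))"
      proof (rule sum.mono_neutral_right)
        show "\<forall>s\<in>S - view r S. (case s of (i, j) \<Rightarrow>
            (p j - \<theta> i) * (r i / b i * q (Suc k) (i, j) S)) = 0"
        proof clarify
          fix i j assume "(i, j) \<in> S" "(i, j) \<notin> view r S"
          moreover from this have "r i = 0"
            using view_in_stock[of i j S r] r(1)[of i] items[OF S]
            by (force elim!: Nats_cases)
          ultimately show "(p j - \<theta> i) * (r i / b i * q (Suc k) (i, j) S) = 0" by simp
        qed
      qed (use view finite_assortment[OF S] in auto)
      also have "\<dots> \<le> (\<Sum>s\<in>view r S. (p (snd s) - \<theta> (fst s)) *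
          (if 0 < r (fst s) then pmf (c r) (Some s) else 0))"
      proof (rule sum_mono)
        fix s assume s: "s \<in> view r S"
        obtain i j where s_eq: "s = (i, j)" by force
        have ij: "(i, j) \<in> view r S" using s s_eq by simp
        have i: "i \<in> {1..n}" and pj: "\<theta> i < p j"
          using ij items[OF view_S[of r]] above_threshold[OF view_S[of r]] by force+
        \<comment> \<open>Substitutability: hiding other products can only raise the rate of a
          product still seen. Together with \<open>r i / b i \<le> 1\<close> the true sale
          probability dominates the weighted rate; at zero stock both vanish.\<close>
        have "q (Suc k) (i, j) S \<le> q (Suc k) (i, j) (view r S)"
          using substitutability k S ij view[of r S] by (auto simp: substitutable_def)
        moreover have "0 \<le> q (Suc k) (i, j) S" by (simp add: q)
        moreover have "0 \<le> r i / b i" "r i / b i \<le> 1"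
          using r[OF i] stock_ge_1[OF i] by (auto elim!: Nats_cases)
        ultimately have "r i / b i * q (Suc k) (i, j) S \<le>
            (if 0 < r i then pmf (c r) (Some (i, j)) else 0)"
          using mult_mono[of "r i / b i" 1 "q (Suc k) (i, j) S" "q (Suc k) (i, j) (view r S)"]
            r(1)[OF i]
          by (auto simp: q c_def zero_less_divide_iff elim!: Nats_cases)
        then have "(p j - \<theta> i) * (r i / b i * q (Suc k) (i, j) S) \<le>
            (p j - \<theta> i) * (if 0 < r i then pmf (c r) (Some (i, j)) else 0)"
          using pj by (intro mult_left_mono) auto
        then show "(case s of (i, j) \<Rightarrow> (p j - \<theta> i) * (r i / b i * q (Suc k) (i, j) S))
          \<le> (p (snd s) - \<theta> (fst s)) * (if 0 < r (fst s) then pmf (c r) (Some s) else 0)"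
          by (simp only: s_eq prod.case fst_conv snd_conv)
      qed
      \<comment> \<open>Choice probabilities become expected indicators, so that
        \<open>purchase_gain\<close> can be applied outcome by outcome.\<close>
      also have "\<dots> = measure_pmf.expectation (c r) (\<lambda>y. \<Sum>s\<in>view r S.
          (p (snd s) - \<theta> (fst s)) * (if 0 < r (fst s) then indicator {Some s} y else 0))"
        by (auto simp: int_c measure_pmf_single intro!: sum.cong)
      finally have "v + (\<Sum>i=1..n. \<theta> i * (r i -
          measure_pmf.expectation (c r) (\<lambda>y. fst (purchase p (r, v) y) i)) +
          r i / b i * surplus (Suc k) i S) \<le>
        measure_pmf.expectation (c r) (\<lambda>y. v +
          (\<Sum>i=1..n. \<theta> i * (r i - fst (purchase p (r, v) y) i)) +
          (\<Sum>s\<in>view r S. (p (snd s) - \<theta> (fst s)) *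
            (if 0 < r (fst s) then indicator {Some s} y else 0)))"
        by (simp add: int_c sum.distrib)
      also have "\<dots> = measure_pmf.expectation (c r) (\<lambda>y. snd (purchase p (r, v) y))"
        using purchase_gain[OF view_S[of r]] set_c[of r]
        by (intro integral_cong_AE) (auto simp: AE_measure_pmf_iff subset_iff)
      finally show ?thesis .
    qed
    \<comment> \<open>For fixed offers the surplus is a constant, so averaging \<open>step\<close>
      over the state after \<open>k\<close> periods replaces \<open>r i\<close> by its mean.\<close>
    have "V k A + (\<Sum>i=1..n. \<theta> i * (R k i A - R (Suc k) i A) + R k i A / b i * surplus (Suc k) i S) =
      measure_pmf.expectation (run A k) (\<lambda>s. snd s + (\<Sum>i=1..n. \<theta> i * (fst s i -
          measure_pmf.expectation (c (fst s)) (\<lambda>y. fst (purchase p s y) i)) +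
          fst s i / b i * surplus (Suc k) i S))"
      by (simp add: V_def R_def E_Suc int)
    also have "\<dots> \<le> V (Suc k) A"
      unfolding V_def E_Suc using step
      by (intro integral_mono_AE int) (auto simp: AE_measure_pmf_iff)
    finally show "V k A + (\<Sum>i=1..n. \<theta> i * (R k i A - R (Suc k) i A) +
        R k i A / b i * surplus (Suc k) i (A (Suc k))) \<le> V (Suc k) A"
      by (simp only: S_def)
  next
    fix A i assume "A \<in> {1..T} \<rightarrow> \<G>" "i \<in> {1..n}"
    then show "0 \<le> R T i A"
      unfolding R_def using supp(2)[of T A]
      by (intro integral_nonneg_AE) (fastforce simp: AE_measure_pmf_iff elim!: Nats_cases)
  qed (simp_all add: V_def R_def run_def integral_run_past del: fun_upd_apply)
qed

end

subsection \<open>Fractional demand\<close>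


text \<open>The counterpart of \<open>expectation_Pi_pmf_insert\<close> for general product
  measures, where integrability has to be assumed.\<close>

lemma expectation_PiM_insert:
  fixes g h :: "_ \<Rightarrow> real"
  assumes "finite I" "i \<notin> I" and M: "\<And>t. t \<in> insert i I \<Longrightarrow> prob_space (M t)"
    and g: "\<And>x y. g (x(i := y)) = g x"
    and int: "integrable (PiM (insert i I) M) (\<lambda>x. g x * h (x i))"
  shows "(\<integral>x. g x * h (x i) \<partial>PiM (insert i I) M) = (\<integral>x. g x \<partial>PiM I M) * (\<integral>y. h y \<partial>M i)"
proof -
  \<comment> \<open>\<open>product_sigma_finite\<close> asks for a sigma-finite measure at every
    index, so \<open>M\<close> is completed by a point mass off the index set; the products in
    question do not change.\<close>
  define M' where "M' t = (if t \<in> insert i I then M t else return (count_space UNIV) undefined)" for t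
  interpret product_sigma_finite M'
    unfolding product_sigma_finite_def M'_def
    using M by (auto intro!: prob_space_imp_sigma_finite prob_space_return)
  have eq: "PiM (insert i I) M = PiM (insert i I) M'" "PiM I M = PiM I M'" "M i = M' i"
    by (auto simp: M'_def intro!: PiM_cong)
  show ?thesis
    unfolding eq using assms(1,2) g int[unfolded eq]
    by (subst product_integral_insert) simp_all
qed

text \<open>The almost sure conditions of \<open>fractional_demand\<close> for one demand vector,
  which allows the stock estimates to be made pathwise.\<close>

definition regular_demand :: "assortment \<Rightarrow> (product \<Rightarrow> real) \<Rightarrow> bool" where
  "regular_demand S d \<longleftrightarrow> (\<forall>s\<in>S. 0 \<le> d s \<and> d s \<le> 1) \<and>
     (\<forall>i j j'. (i, j) \<in> S \<and> (i, j') \<in> S \<and> j \<noteq> j' \<longrightarrow> \<not> (0 < d (i, j) \<and> 0 < d (i, j')))"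

text \<open>At most one product of item \<open>i\<close> has positive demand, so at most one summand
  is nonzero. Hence the stock cannot become negative although each \<open>min\<close> refers to the
  stock at the start of the period.\<close>

lemma regular_demand_sales:
  assumes d: "regular_demand S d" and "finite S" and r: "0 \<le> r"
  shows "0 \<le> (\<Sum>j | (i, j) \<in> S. min (d (i, j)) r)" "(\<Sum>j | (i, j) \<in> S. min (d (i, j)) r) \<le> r"
proof -
  let ?J = "{j. (i, j) \<in> S}"
  show "0 \<le> (\<Sum>j\<in>?J. min (d (i, j)) r)"
    using d r by (intro sum_nonneg) (auto simp: regular_demand_def)
  have fin: "finite ?J"
    by (rule finite_subset[of _ "snd ` S"]) (use assms(2) in force)+
  show "(\<Sum>j\<in>?J. min (d (i, j)) r) \<le> r"
  proof (cases "\<exists>j\<in>?J. 0 < d (i, j)")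
    case True
    then obtain j where j: "j \<in> ?J" "0 < d (i, j)" by blast
    have "min (d (i, j')) r = 0" if "j' \<in> ?J - {j}" for j'
    proof -
      have "\<not> 0 < d (i, j')" "0 \<le> d (i, j')"
        using d j that unfolding regular_demand_def by blast+
      then show ?thesis using r by simp
    qed
    then have "(\<Sum>j\<in>?J. min (d (i, j)) r) = (\<Sum>j\<in>{j}. min (d (i, j)) r)"
      using fin j by (intro sum.mono_neutral_right) auto
    then show ?thesis by simp
  next
    case False
    then have "(\<Sum>j\<in>?J. min (d (i, j)) r) \<le> (\<Sum>j\<in>?J. 0)"
      by (intro sum_mono) (auto simp: not_less)
    then show ?thesis using r by simp
  qed
qed

section \<open>Dependence of fractional stock and revenue on past periods\<close>

lemma fractional_stock_cong:
  assumes "\<And>t. t \<in> {1..k} \<Longrightarrow> A t = A' t" "\<And>t. t \<in> {1..k} \<Longrightarrow> d t = d' t"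
  shows "fractional_stock b A d k i = fractional_stock b A' d' k i"
  using assms
proof (induction k)
  case (Suc k)
  have "fractional_stock b A d k i = fractional_stock b A' d' k i"
    by (rule Suc.IH) (simp_all add: Suc.prems)
  moreover have "A (Suc k) = A' (Suc k)" "d (Suc k) = d' (Suc k)"
    by (rule Suc.prems, simp)+
  ultimately show ?case by (simp only: fractional_stock.simps)
qed simp

lemma fractional_revenue_cong:
  assumes "\<And>t. t \<in> {1..k} \<Longrightarrow> A t = A' t" "\<And>t. t \<in> {1..k} \<Longrightarrow> d t = d' t"
  shows "fractional_revenue k p b A d = fractional_revenue k p b A' d'"
  unfolding fractional_revenue_def
proof (rule sum.cong)
  fix t assume t: "t \<in> {1..k}"
  have "fractional_stock b A d (t - 1) i = fractional_stock b A' d' (t - 1) i" for i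
    using t by (intro fractional_stock_cong assms) auto
  then show "(\<Sum>(i, j)\<in>A t. p j * min (d t (i, j)) (fractional_stock b A d (t - 1) i)) =
      (\<Sum>(i, j)\<in>A' t. p j * min (d' t (i, j)) (fractional_stock b A' d' (t - 1) i))"
    using assms[OF t] by simp
qed simp

lemma fractional_revenue_Suc:
  "fractional_revenue (Suc k) p b A d = fractional_revenue k p b A d +
    (\<Sum>(i, j)\<in>A (Suc k). p j * min (d (Suc k) (i, j)) (fractional_stock b A d k i))"
  by (simp add: fractional_revenue_def)

section \<open>Expected revenue under fractional demand\<close>

context price_threshold
begin

lemma AE_regular_demand:
  assumes "fractional_demand T \<G> L" "t \<in> {1..T}" "S \<in> \<G>"
  shows "AE d in L t S. regular_demand S d"
proof -
  have "AE d in L t S. \<forall>s\<in>S. 0 \<le> d s \<and> d s \<le> 1"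
    "AE d in L t S. \<forall>i j j'. (i, j) \<in> S \<and> (i, j') \<in> S \<and> j \<noteq> j' \<longrightarrow>
           \<not> (0 < d (i, j) \<and> 0 < d (i, j'))"
    using assms by (auto simp: fractional_demand_def)
  then show ?thesis
    unfolding regular_demand_def by (rule eventually_conj)
qed

lemma fractional_stock_bounds:
  assumes "A \<in> {1..k} \<rightarrow> \<G>" "\<forall>t\<in>{1..k}. regular_demand (A t) (d t)" and i: "i \<in> {1..n}"
  shows "0 \<le> fractional_stock b A d k i \<and> fractional_stock b A d k i \<le> b i"
  using assms(1,2)
proof (induction k)
  case 0
  then show ?case using stock_ge_1[OF i] by simp
next
  case (Suc k)
  then have IH: "0 \<le> fractional_stock b A d k i \<and> fractional_stock b A d k i \<le> b i"
    by (simp add: Pi_iff)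
  have "regular_demand (A (Suc k)) (d (Suc k))" "finite (A (Suc k))"
    using Suc.prems finite_assortment by (auto simp: Pi_iff)
  from regular_demand_sales[OF this, of "fractional_stock b A d k i" i] IH
  show ?case by simp
qed

text \<open>A sale \<open>min d R\<close> is at least the demanded share \<open>R / b\<close> of the stock, because \<open>d \<le> 1 \<le> b\<close>.\<close>

lemma fractional_revenue_step:
  assumes A: "A \<in> {1..Suc k} \<rightarrow> \<G>" and d: "\<forall>t\<in>{1..Suc k}. regular_demand (A t) (d t)"
  shows "fractional_revenue k p b A d +
      (\<Sum>i=1..n. \<theta> i * (fractional_stock b A d k i - fractional_stock b A d (Suc k) i)) +
      (\<Sum>(i, j)\<in>A (Suc k). (p j - \<theta> i) * (fractional_stock b A d k i * d (Suc k) (i, j) / b i))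
    \<le> fractional_revenue (Suc k) p b A d"
proof -
  let ?R = "fractional_stock b A d k" and ?S = "A (Suc k)" and ?d = "d (Suc k)"
  have S: "?S \<in> \<G>" using A by auto
  have "(p j - \<theta> i) * (?R i * ?d (i, j) / b i) \<le> (p j - \<theta> i) * min (?d (i, j)) (?R i)"
    if ij: "(i, j) \<in> ?S" for i j
  proof -
    have i: "i \<in> {1..n}" using items[OF S] ij by force
    have R: "0 \<le> ?R i" "?R i \<le> b i"
      using fractional_stock_bounds[OF _ _ i, of A k d] A d by (auto simp: Pi_iff)
    have y: "0 \<le> ?d (i, j)" "?d (i, j) \<le> 1"
      using d ij by (auto simp: regular_demand_def)
    have b: "1 \<le> b i" by (rule stock_ge_1[OF i])
    have "?R i * ?d (i, j) \<le> b i * ?d (i, j)" using R y by (intro mult_right_mono)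
    moreover have "?R i * ?d (i, j) \<le> ?R i * b i" using R y b by (intro mult_left_mono) auto
    ultimately have "?R i * ?d (i, j) / b i \<le> min (?d (i, j)) (?R i)"
      using b by (simp add: divide_le_eq mult.commute)
    then show ?thesis
      using above_threshold[OF S ij] by (intro mult_left_mono) auto
  qed
  then have "(\<Sum>(i, j)\<in>?S. (p j - \<theta> i) * (?R i * ?d (i, j) / b i)) \<le>
      (\<Sum>(i, j)\<in>?S. (p j - \<theta> i) * min (?d (i, j)) (?R i))"
    by (intro sum_mono) auto
  \<comment> \<open>The stock lost by an item equals its sales, so the first part of the price
    splitting is an identity.\<close>
  moreover have "(\<Sum>i=1..n. \<theta> i * (?R i - fractional_stock b A d (Suc k) i)) =
      (\<Sum>(i, j)\<in>?S. \<theta> i * min (?d (i, j)) (?R i))"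
    by (simp add: sum_items[OF S] sum_distrib_left)
  moreover have "(\<Sum>(i, j)\<in>?S. p j * min (?d (i, j)) (?R i)) =
      (\<Sum>(i, j)\<in>?S. \<theta> i * min (?d (i, j)) (?R i)) +
      (\<Sum>(i, j)\<in>?S. (p j - \<theta> i) * min (?d (i, j)) (?R i))"
    by (simp add: sum.distrib[symmetric] split_beta algebra_simps)
  ultimately show ?thesis by (simp only: fractional_revenue_Suc)
qed

text \<open>For fixed offers the demands form a product measure. Integrability comes from the almost
  sure bounds on stocks and demands, and the pathwise step is then integrated.\<close>

lemma fractional_revenue_bound:
  assumes q: "q = (\<lambda>t s S. \<integral>d. d s \<partial>L t S)" and L: "fractional_demand T \<G> L"
  shows "(\<Sum>i=1..n. \<theta> i * b i) \<le> measure_pmf.expectation (Pi_pmf {1..T} dflt \<mu>)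
    (\<lambda>A. \<integral>d. fractional_revenue T p b A d \<partial>PiM {1..T} (\<lambda>t. L t (A t)))"
proof -
  define P where "P A k = PiM {1..k} (\<lambda>t. L t (A t))" for A k
  define V where "V k A = (\<integral>d. fractional_revenue k p b A d \<partial>P A k)" for k A
  define R where "R k i A = (\<integral>d. fractional_stock b A d k i \<partial>P A k)" for k i A
  \<comment> \<open>\<open>A\<close> is controlled only on \<open>{1..k}\<close>, so every fact
    about \<open>L t (A t)\<close> is confined to these periods.\<close>
  have prob: "prob_space (L t (A t))" and sets: "sets (L t (A t)) = sets (PiM (A t) (\<lambda>_. borel))"
    if "A \<in> {1..k} \<rightarrow> \<G>" "k \<le> T" "t \<in> {1..k}" for A k t
  proof -
    have "t \<in> {1..T}" "A t \<in> \<G>" using that by (auto simp: Pi_iff)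
    then show "prob_space (L t (A t))" "sets (L t (A t)) = sets (PiM (A t) (\<lambda>_. borel))"
      using L unfolding fractional_demand_def by blast+
  qed
  have prob_P: "prob_space (P A k)" if "A \<in> {1..k} \<rightarrow> \<G>" "k \<le> T" for A k
    unfolding P_def using prob[OF that] by (rule prob_space_PiM)
  have AE_P: "AE d in P A k. \<forall>t\<in>{1..k}. regular_demand (A t) (d t)"
    if "A \<in> {1..k} \<rightarrow> \<G>" "k \<le> T" for A k
    unfolding P_def using that
    by (intro AE_finite_allI AE_PiM_component prob[OF that] AE_regular_demand[OF L]) auto
  have meas: "(\<lambda>d. d t s) \<in> borel_measurable (P A k)"
    if "A \<in> {1..k} \<rightarrow> \<G>" "k \<le> T" "t \<in> {1..k}" "s \<in> A t" for A k t s
  proof -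
    have "(\<lambda>d. d t) \<in> P A k \<rightarrow>\<^sub>M L t (A t)"
      unfolding P_def using that(3) by (rule measurable_component_singleton)
    moreover have "(\<lambda>y. y s) \<in> borel_measurable (L t (A t))"
      using measurable_component_singleton[OF that(4), of "\<lambda>_. borel"]
      by (simp cong: measurable_cong_sets add: sets[OF that(1-3)])
    ultimately show ?thesis by (rule measurable_compose)
  qed
  have meas_stock: "(\<lambda>d. fractional_stock b A d l i) \<in> borel_measurable (P A k)"
    if "A \<in> {1..k} \<rightarrow> \<G>" "k \<le> T" "l \<le> k" for A k l i
    using that(3)
  proof (induction l)
    case (Suc l)
    then show ?case
      using meas[OF that(1,2)]
      by (auto intro!: borel_measurable_diff borel_measurable_sum borel_measurable_min)
  qed simp
  show ?thesis
    unfolding P_def[symmetric] V_def[symmetric]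
  proof (rule revenue_bound[where R = R])
    fix k A assume k: "k < T" and A: "A \<in> {1..Suc k} \<rightarrow> \<G>"
    have A': "A \<in> {1..k} \<rightarrow> \<G>" and S: "A (Suc k) \<in> \<G>" using A by (auto simp: Pi_iff)
    note A_Suc = A Suc_leI[OF k]
    have Suc_k: "Suc k \<in> {1..Suc k}" by simp
    interpret prob_space "P A (Suc k)" by (rule prob_P[OF A_Suc])
    have AE_stock: "AE d in P A (Suc k). 0 \<le> fractional_stock b A d l i \<and> fractional_stock b A d l i \<le> b i"
      if "l \<le> Suc k" "i \<in> {1..n}" for l i
      using AE_P[OF A_Suc]
    proof eventually_elim
      case (elim d)
      then show ?case
        using that A by (intro fractional_stock_bounds) (auto simp: Pi_iff)
    qed
    have AE_demand: "AE d in P A (Suc k). 0 \<le> d t s \<and> d t s \<le> 1"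
      if "t \<in> {1..Suc k}" "s \<in> A t" for t s
      using AE_P[OF A_Suc] by eventually_elim (use that in \<open>auto simp: regular_demand_def\<close>)
    have int_stock: "integrable (P A (Suc k)) (\<lambda>d. fractional_stock b A d l i)"
      if "l \<le> Suc k" "i \<in> {1..n}" for l i
      using AE_stock[OF that] that
      by (intro integrable_const_bound[where B = "b i"] meas_stock[OF A_Suc]) auto
    have int_share: "integrable (P A (Suc k)) (\<lambda>d. fractional_stock b A d k i * d (Suc k) (i, j))"
      if ij: "(i, j) \<in> A (Suc k)" for i j
    proof (rule integrable_const_bound[where B = "b i"])
      have i: "i \<in> {1..n}" using items[OF S] ij by force
      show "AE d in P A (Suc k). norm (fractional_stock b A d k i * d (Suc k) (i, j)) \<le> b i"
        using AE_stock[OF le_SucI[OF order_refl[of k]] i] AE_demand[OF Suc_k ij]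
      proof eventually_elim
        case (elim d)
        then have "fractional_stock b A d k i * d (Suc k) (i, j) \<le> fractional_stock b A d k i"
          by (intro mult_left_le) auto
        then show ?case using elim by simp
      qed
    qed (use meas[OF A_Suc Suc_k ij] meas_stock[OF A_Suc] in auto)
    have int_sale: "integrable (P A (Suc k)) (\<lambda>d. min (d t (i, j)) (fractional_stock b A d (t - 1) i))"
      if t: "t \<in> {1..Suc k}" and ij: "(i, j) \<in> A t" for t i j
    proof (rule integrable_const_bound[where B = 1])
      have i: "i \<in> {1..n}" using items[of "A t"] t A ij by force
      have "t - 1 \<le> Suc k" using t by auto
      from AE_stock[OF this i] AE_demand[OF t ij]
      show "AE d in P A (Suc k). norm (min (d t (i, j)) (fractional_stock b A d (t - 1) i)) \<le> 1"
        by eventually_elim auto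
    qed (use t meas[OF A_Suc t ij] meas_stock[OF A_Suc] in auto)
    have int_revenue: "integrable (P A (Suc k)) (\<lambda>d. fractional_revenue l p b A d)"
      if "l \<le> Suc k" for l
      unfolding fractional_revenue_def using int_sale that
      by (auto simp: split_beta intro!: Bochner_Integration.integrable_sum)
    have E_Suc: "(\<integral>d. g d * h (d (Suc k)) \<partial>P A (Suc k)) =
        (\<integral>d. g d \<partial>P A k) * (\<integral>y. h y \<partial>L (Suc k) (A (Suc k)))"
      if "\<And>d y. g (d(Suc k := y)) = g d" "integrable (P A (Suc k)) (\<lambda>d. g d * h (d (Suc k)))"
      for g :: "_ \<Rightarrow> real" and h :: "_ \<Rightarrow> real"
    proof -
      have ins: "{1..Suc k} = insert (Suc k) {1..k}" by auto
      show ?thesis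
        unfolding P_def ins
        by (rule expectation_PiM_insert[where M = "\<lambda>t. L t (A t)"])
          (use that(1) that(2)[unfolded P_def ins] prob[OF A_Suc] in auto)
    qed
    have E_Suc': "(\<integral>d. g d \<partial>P A (Suc k)) = (\<integral>d. g d \<partial>P A k)"
      if "\<And>d y. g (d(Suc k := y)) = g d" "integrable (P A (Suc k)) g" for g :: "_ \<Rightarrow> real"
      using E_Suc[of g "\<lambda>_. 1"] that prob[OF A_Suc, of "Suc k"] by (simp add: prob_space.prob_space)
    have stock_past: "fractional_stock b A (d(Suc k := y)) k i = fractional_stock b A d k i" for d y i
      by (rule fractional_stock_cong) auto
    have revenue_past: "fractional_revenue k p b A (d(Suc k := y)) = fractional_revenue k p b A d" for d y
      by (rule fractional_revenue_cong) auto
    \<comment> \<open>Adding the coordinate of period \<open>Suc k\<close> does not affect the stock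
      after \<open>k\<close> periods, so all integrals can be taken on the same space.\<close>
    have R_Suc: "R k i A = (\<integral>d. fractional_stock b A d k i \<partial>P A (Suc k))" if "i \<in> {1..n}" for i
      unfolding R_def using that by (intro E_Suc'[symmetric] stock_past int_stock) auto
    show "R (Suc k) i A \<le> R k i A" if i: "i \<in> {1..n}" for i
      unfolding R_Suc[OF i] unfolding R_def
    proof (intro integral_mono_AE int_stock i)
      show "AE d in P A (Suc k). fractional_stock b A d (Suc k) i \<le> fractional_stock b A d k i"
        using AE_P[OF A_Suc] AE_stock[OF le_SucI[OF order_refl[of k]] i]
      proof eventually_elim
        case (elim d)
        then show ?case
          using regular_demand_sales(1)[of "A (Suc k)" "d (Suc k)" "fractional_stock b A d k i" i]
            finite_assortment[OF S] by simp
      qed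
    qed auto
    \<comment> \<open>Independence across periods: the stock is a function of the first
      \<open>k\<close> demands and is multiplied by the demand of period
      \<open>Suc k\<close>.\<close>
    have share: "(\<integral>d. fractional_stock b A d k i * d (Suc k) (i, j) \<partial>P A (Suc k)) =
        R k i A * q (Suc k) (i, j) (A (Suc k))" if "(i, j) \<in> A (Suc k)" for i j
      unfolding R_def q using that int_share by (intro E_Suc stock_past) auto
    have "(\<Sum>i=1..n. R k i A / b i * surplus (Suc k) i (A (Suc k))) =
        (\<Sum>(i, j)\<in>A (Suc k). (p j - \<theta> i) * (R k i A * q (Suc k) (i, j) (A (Suc k)) / b i))"
      using sum_surplus[OF S, of "\<lambda>i. R k i A / b i" "Suc k"] by simp
    also have "\<dots> = (\<Sum>(i, j)\<in>A (Suc k). (p j - \<theta> i) *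
        ((\<integral>d. fractional_stock b A d k i * d (Suc k) (i, j) \<partial>P A (Suc k)) / b i))"
      by (intro sum.cong) (auto simp: share)
    also have "\<dots> = (\<integral>d. (\<Sum>(i, j)\<in>A (Suc k). (p j - \<theta> i) *
        (fractional_stock b A d k i * d (Suc k) (i, j) / b i)) \<partial>P A (Suc k))"
      using int_share by (subst Bochner_Integration.integral_sum) (auto simp: split_beta)
    finally have surplus: "(\<Sum>i=1..n. R k i A / b i * surplus (Suc k) i (A (Suc k))) = \<dots>" .
    have int_surplus: "integrable (P A (Suc k)) (\<lambda>d. \<Sum>(i, j)\<in>A (Suc k). (p j - \<theta> i) *
        (fractional_stock b A d k i * d (Suc k) (i, j) / b i))"
      using int_share by (auto simp: split_beta intro!: Bochner_Integration.integrable_sum)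
    have int_sold: "integrable (P A (Suc k)) (\<lambda>d. \<Sum>i=1..n. \<theta> i *
        (fractional_stock b A d k i - fractional_stock b A d (Suc k) i))"
      by (intro Bochner_Integration.integrable_sum integrable_mult_right
          Bochner_Integration.integrable_diff int_stock) auto
    have "V k A + (\<Sum>i=1..n. \<theta> i * (R k i A - R (Suc k) i A) +
        R k i A / b i * surplus (Suc k) i (A (Suc k))) =
      (\<integral>d. fractional_revenue k p b A d \<partial>P A (Suc k)) +
      (\<integral>d. (\<Sum>i=1..n. \<theta> i * (fractional_stock b A d k i - fractional_stock b A d (Suc k) i))
        \<partial>P A (Suc k)) +
      (\<integral>d. (\<Sum>(i, j)\<in>A (Suc k). (p j - \<theta> i) *
        (fractional_stock b A d k i * d (Suc k) (i, j) / b i)) \<partial>P A (Suc k))"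
    proof -
      have "(\<integral>d. fractional_revenue k p b A d \<partial>P A (Suc k)) = V k A"
        unfolding V_def by (intro E_Suc' revenue_past int_revenue) auto
      moreover have "(\<integral>d. (\<Sum>i=1..n. \<theta> i * (fractional_stock b A d k i - fractional_stock b A d (Suc k) i))
          \<partial>P A (Suc k)) = (\<Sum>i=1..n. \<theta> i * (R k i A - R (Suc k) i A))"
        using int_stock R_Suc unfolding R_def[of "Suc k"]
        by (subst Bochner_Integration.integral_sum) (auto simp del: fractional_stock.simps intro!: sum.cong)
      ultimately show ?thesis
        by (simp only: sum.distrib surplus add.assoc)
    qed
    also have "\<dots> = (\<integral>d. fractional_revenue k p b A d +
        (\<Sum>i=1..n. \<theta> i * (fractional_stock b A d k i - fractional_stock b A d (Suc k) i)) +
        (\<Sum>(i, j)\<in>A (Suc k). (p j - \<theta> i) *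
        (fractional_stock b A d k i * d (Suc k) (i, j) / b i)) \<partial>P A (Suc k))"
      using int_revenue[of k] int_sold int_surplus by (simp del: fractional_stock.simps)
    also have "\<dots> \<le> V (Suc k) A"
      unfolding V_def
    proof (rule integral_mono_AE)
      show "AE d in P A (Suc k). fractional_revenue k p b A d +
        (\<Sum>i=1..n. \<theta> i * (fractional_stock b A d k i - fractional_stock b A d (Suc k) i)) +
        (\<Sum>(i, j)\<in>A (Suc k). (p j - \<theta> i) *
        (fractional_stock b A d k i * d (Suc k) (i, j) / b i)) \<le> fractional_revenue (Suc k) p b A d"
        using AE_P[OF A_Suc] by eventually_elim (rule fractional_revenue_step[OF A])
    qed (use int_revenue[of k] int_revenue[of "Suc k"] int_sold int_surplus
        in \<open>auto simp del: fractional_stock.simps\<close>)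
    finally show "V k A + (\<Sum>i=1..n. \<theta> i * (R k i A - R (Suc k) i A) +
        R k i A / b i * surplus (Suc k) i (A (Suc k))) \<le> V (Suc k) A" .
  next
    fix A i assume A: "A \<in> {1..T} \<rightarrow> \<G>" and i: "i \<in> {1..n}"
    show "0 \<le> R T i A"
      unfolding R_def
    proof (rule integral_nonneg_AE)
      show "AE d in P A T. 0 \<le> fractional_stock b A d T i"
        using AE_P[OF A order_refl] by eventually_elim (use fractional_stock_bounds[OF A _ i] in auto)
    qed
  next
    fix A show "V 0 A = 0" by (simp add: V_def fractional_revenue_def)
  next
    fix A i show "R 0 i A = b i"
      using prob_P[of A 0] by (simp add: R_def prob_space.prob_space)
  next
    fix k A S
    have P: "P (A(Suc k := S)) k = P A k"
      unfolding P_def by (rule PiM_cong) auto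
    show "V k (A(Suc k := S)) = V k A"
      unfolding V_def P by (intro Bochner_Integration.integral_cong fractional_revenue_cong) auto
    show "R k i (A(Suc k := S)) = R k i A" for i
      unfolding R_def P by (intro Bochner_Integration.integral_cong fractional_stock_cong) auto
  qed
qed

end


subsection \<open>The guarantee of the algorithm\<close>

lemma rate_nonneg:
  assumes "valid_model n T b \<S> D" "t \<in> {1..T}" "S \<in> \<S>" "s \<in> S"
  shows "0 \<le> rate D t s S"
proof (cases D)
  case (Static_Fractional L)
  then have "AE d in L t S. \<forall>s\<in>S. 0 \<le> d s \<and> d s \<le> 1"
    using assms by (auto simp: fractional_demand_def)
  then have "AE d in L t S. 0 \<le> d s"
    by eventually_elim (use assms(4) in auto)
  then show ?thesis by (simp add: Static_Fractional integral_nonneg_AE)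
qed simp_all

text \<open>The weights are nonnegative and sum to one, so \<open>embed_pmf\<close> really has them
  as its probabilities.\<close>

lemma pmf_draw:
  assumes "finite \<S>" "\<And>S. S \<in> \<S> \<Longrightarrow> 0 \<le> w S" "(\<Sum>S\<in>\<S>. w S) = 1"
  shows "pmf (draw \<S> w) S = (if S \<in> \<S> then w S else 0)"
  unfolding draw_def
proof (rule pmf_embed_pmf)
  have "(\<integral>\<^sup>+ S. ennreal (if S \<in> \<S> then w S else 0) \<partial>count_space UNIV) = (\<Sum>S\<in>\<S>. ennreal (w S))"
    using assms(1) by (subst nn_integral_count_space'[of \<S>]) auto
  also have "\<dots> = 1"
    using assms(2,3) by (simp add: sum_ennreal)
  finally show "(\<integral>\<^sup>+ S. ennreal (if S \<in> \<S> then w S else 0) \<partial>count_space UNIV) = 1" .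
qed (use assms(2) in simp)

theorem theorem2:
  fixes n m T :: nat
    and p b :: "nat \<Rightarrow> real"
    and \<S> :: "assortment set"
    and D :: demand_model
    and x :: "nat \<Rightarrow> assortment \<Rightarrow> real"
  assumes price_pos: "\<forall>j\<in>{1..m}. 0 < p j"
    and inventory: "\<forall>i\<in>{1..n}. 1 \<le> b i \<and> b i \<le> real T"
    and assortments: "\<S> \<subseteq> Pow ({1..n} \<times> {1..m})"
    and empty: "{} \<in> \<S>"
    and downward_closed: "\<forall>S\<in>\<S>. \<forall>S'. S' \<subseteq> S \<longrightarrow> S' \<in> \<S>"
    and model: "valid_model n T b \<S> D"
    and subst: "substitutable T \<S> (rate D)"
    and optimal: "cdlp_optimal n T p b \<S> (rate D) x"
  shows "measure_pmf.expectation (algorithm2 T p b \<S> (rate D) x) (expected_revenue T p b D)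
           \<ge> OPT_LP n T p b \<S> (rate D) / 2"
proof -
  define q where "q = rate D"
  define r where "r = item_revenue T p \<S> q x"
  \<comment> \<open>Half of the LP revenue of item \<open>i\<close> per unit of its
    inventory.\<close>
  define \<theta> where "\<theta> i = r i / (2 * b i)" for i
  define offer where "offer S = {(i, j) \<in> S. p j > \<theta> i}" for S
  define \<G> where "\<G> = {S \<in> \<S>. \<forall>(i, j)\<in>S. \<theta> i < p j}"
  define \<mu> where "\<mu> t = map_pmf offer (draw \<S> (x t))" for t
  have fin_\<S>: "finite \<S>"
    using assortments by (rule finite_subset) simp
  have fin: "finite S" if "S \<in> \<S>" for S
    by (rule finite_subset[of _ "{1..n} \<times> {1..m}"]) (use assortments that in auto)
  have S_items: "fst ` S \<subseteq> {1..n}" "snd ` S \<subseteq> {1..m}" if "S \<in> \<S>" for S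
    using assortments that by force+
  have fin_J: "finite {j. (i, j) \<in> S}" if "S \<in> \<S>" for i S
    by (rule finite_subset[of _ "{1..m}"]) (use S_items(2)[OF that] in force)+
  have load: "(\<Sum>t=1..T. \<Sum>S\<in>\<S>. x t S * (\<Sum>j | (i, j) \<in> S. q t (i, j) S)) \<le> b i"
    if "i \<in> {1..n}" for i
    using optimal that by (simp add: cdlp_optimal_def cdlp_feasible_def q_def)
  have x_nonneg: "0 \<le> x t S" if "t \<in> {1..T}" "S \<in> \<S>" for t S
    using optimal that by (simp add: cdlp_optimal_def cdlp_feasible_def)
  have x_sum: "(\<Sum>S\<in>\<S>. x t S) = 1" if "t \<in> {1..T}" for t
    using optimal that by (simp add: cdlp_optimal_def cdlp_feasible_def)
  have q_nonneg: "0 \<le> q t s S" if "t \<in> {1..T}" "S \<in> \<S>" "s \<in> S" for t s S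
    unfolding q_def using model that by (rule rate_nonneg)
  have b_ge_1: "1 \<le> b i" if "i \<in> {1..n}" for i
    using inventory that by blast
  have r_nonneg: "0 \<le> r i" for i
    unfolding r_def item_revenue_def
  proof (intro sum_nonneg mult_nonneg_nonneg)
    fix t S j assume "S \<in> \<S>" "j \<in> {j. (i, j) \<in> S}"
    then have "j \<in> {1..m}" using S_items(2)[of S] by force
    then show "0 \<le> p j" using price_pos by (simp add: less_imp_le)
  qed (use x_nonneg q_nonneg in auto)
  have \<theta>_nonneg: "0 \<le> \<theta> i" if "i \<in> {1..n}" for i
    unfolding \<theta>_def using r_nonneg b_ge_1[OF that] by simp
  have \<theta>_b: "\<theta> i * b i = r i / 2" if "i \<in> {1..n}" for i
    unfolding \<theta>_def using b_ge_1[OF that] by simp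
  have pmf_x: "pmf (draw \<S> (x t)) S = (if S \<in> \<S> then x t S else 0)" if "t \<in> {1..T}" for t S
    using that by (intro pmf_draw fin_\<S> x_nonneg x_sum)
  have set_x: "set_pmf (draw \<S> (x t)) \<subseteq> \<S>" if "t \<in> {1..T}" for t
    using pmf_x[OF that] by (auto simp: set_pmf_eq split: if_splits)
  have offer_subset: "offer S \<subseteq> S" for S
    by (auto simp: offer_def)
  have offer_\<S>: "offer S \<in> \<S>" if "S \<in> \<S>" for S
    using downward_closed that offer_subset by blast
  \<comment> \<open>Products priced at most \<theta> contribute nonpositive surplus, so dropping
    them loses nothing; substitutability then raises the rates of those kept.\<close>
  have surplus_offer: "(\<Sum>j | (i, j) \<in> S. (p j - \<theta> i) * q t (i, j) S) \<le>
      (\<Sum>j | (i, j) \<in> offer S. (p j - \<theta> i) * q t (i, j) (offer S))"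
    if "t \<in> {1..T}" "S \<in> \<S>" for t S i
  proof -
    have "(\<Sum>j | (i, j) \<in> S. (p j - \<theta> i) * q t (i, j) S) \<le>
        (\<Sum>j | (i, j) \<in> S. if \<theta> i < p j then (p j - \<theta> i) * q t (i, j) S else 0)"
      using q_nonneg[OF that] by (intro sum_mono) (auto intro: mult_nonpos_nonneg)
    also have "\<dots> = (\<Sum>j | (i, j) \<in> offer S. (p j - \<theta> i) * q t (i, j) S)"
      using fin_J[OF that(2)] by (simp add: sum.If_cases offer_def Collect_conj_eq)
    also have "\<dots> \<le> (\<Sum>j | (i, j) \<in> offer S. (p j - \<theta> i) * q t (i, j) (offer S))"
    proof (intro sum_mono mult_left_mono)
      fix j assume "j \<in> {j. (i, j) \<in> offer S}"
      then show "q t (i, j) S \<le> q t (i, j) (offer S)"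
        using subst that offer_subset by (auto simp: substitutable_def q_def)
    qed (auto simp: offer_def)
    finally show ?thesis .
  qed
  interpret price_threshold n T p b \<theta> \<G> q \<mu>
  proof
    fix S assume S: "S \<in> \<G>"
    then have "S \<in> \<S>" by (simp add: \<G>_def)
    then show "finite S" "fst ` S \<subseteq> {1..n}" by (rule fin S_items)+
    show "\<theta> i < p j" if "(i, j) \<in> S" for i j
      using S that by (auto simp: \<G>_def)
    show "S' \<in> \<G>" if "S' \<subseteq> S" for S'
      using S that downward_closed by (auto simp: \<G>_def)
    show "0 \<le> q t s S" if "t \<in> {1..T}" "s \<in> S" for t s
      using that \<open>S \<in> \<S>\<close> by (intro q_nonneg)
  next
    show "finite \<G>" using fin_\<S> by (simp add: \<G>_def)
    show "substitutable T \<G> q"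
      using subst by (auto simp: substitutable_def q_def \<G>_def)
    show "1 \<le> b i" if "i \<in> {1..n}" for i by (rule b_ge_1[OF that])
    show "set_pmf (\<mu> t) \<subseteq> \<G>" if "t \<in> {1..T}" for t
      using set_x[OF that] offer_\<S> by (auto simp: \<mu>_def \<G>_def) (auto simp: offer_def)
    fix i assume i: "i \<in> {1..n}"
    \<comment> \<open>The factor 2 in the threshold balances the two parts: the LP surplus left
      after paying \<theta> for the full capacity is again \<open>\<theta> i * b i\<close>.\<close>
    have "\<theta> i * b i = r i - \<theta> i * b i"
      using \<theta>_b[OF i] by simp
    \<comment> \<open>The capacity constraint, using that \<theta> is nonnegative.\<close>
    also have "\<dots> \<le> r i - \<theta> i *
        (\<Sum>t=1..T. \<Sum>S\<in>\<S>. x t S * (\<Sum>j | (i, j) \<in> S. q t (i, j) S))"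
      using load[OF i] \<theta>_nonneg[OF i] by (simp add: mult_left_mono)
    also have "\<dots> = (\<Sum>t=1..T. \<Sum>S\<in>\<S>. x t S * (\<Sum>j | (i, j) \<in> S. (p j - \<theta> i) * q t (i, j) S))"
      unfolding r_def item_revenue_def
      by (simp add: sum_distrib_left sum_subtractf[symmetric] algebra_simps)
    also have "\<dots> \<le> (\<Sum>t=1..T. \<Sum>S\<in>\<S>. x t S *
        (\<Sum>j | (i, j) \<in> offer S. (p j - \<theta> i) * q t (i, j) (offer S)))"
      by (intro sum_mono mult_left_mono surplus_offer x_nonneg)
    also have "\<dots> = (\<Sum>t=1..T. measure_pmf.expectation (\<mu> t)
        (\<lambda>S. \<Sum>j | (i, j) \<in> S. (p j - \<theta> i) * q t (i, j) S))"
    proof (rule sum.cong)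
      fix t assume t: "t \<in> {1..T}"
      show "(\<Sum>S\<in>\<S>. x t S * (\<Sum>j | (i, j) \<in> offer S. (p j - \<theta> i) * q t (i, j) (offer S))) =
          measure_pmf.expectation (\<mu> t) (\<lambda>S. \<Sum>j | (i, j) \<in> S. (p j - \<theta> i) * q t (i, j) S)"
        unfolding \<mu>_def integral_map_pmf using set_x[OF t]
        by (subst integral_measure_pmf[OF fin_\<S>]) (auto simp: pmf_x[OF t])
    qed simp
    finally show "\<theta> i * b i \<le> (\<Sum>t=1..T. measure_pmf.expectation (\<mu> t)
        (\<lambda>S. \<Sum>j | (i, j) \<in> S. (p j - \<theta> i) * q t (i, j) S))" .
  qed
  \<comment> \<open>The supremum is attained at \<open>x\<close>; regrouping the objective by item
    turns it into the sum of the \<open>r i\<close>.\<close>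
  have "OPT_LP n T p b \<S> (rate D) = cdlp_objective T p \<S> q x"
    unfolding OPT_LP_def q_def using optimal
    by (intro cSup_eq_maximum) (auto simp: cdlp_optimal_def)
  also have "\<dots> = (\<Sum>t=1..T. \<Sum>S\<in>\<S>. \<Sum>i=1..n. x t S * (\<Sum>j | (i, j) \<in> S. p j * q t (i, j) S))"
    unfolding cdlp_objective_def sum_distrib_left[symmetric] using fin S_items
    by (intro sum.cong arg_cong2[where f = "(*)"] sum_by_fst) auto
  also have "\<dots> = (\<Sum>t=1..T. \<Sum>i=1..n. \<Sum>S\<in>\<S>. x t S * (\<Sum>j | (i, j) \<in> S. p j * q t (i, j) S))"
    by (rule sum.cong[OF refl], rule sum.swap)
  also have "\<dots> = (\<Sum>i=1..n. r i)"
    unfolding r_def item_revenue_def by (rule sum.swap)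
  finally have "OPT_LP n T p b \<S> (rate D) / 2 = (\<Sum>i=1..n. \<theta> i * b i)"
    by (simp add: \<theta>_b sum_divide_distrib)
  also have "\<dots> \<le> measure_pmf.expectation (Pi_pmf {1..T} {} \<mu>) (expected_revenue T p b D)"
  proof (cases D)
    case (Static_Integral C)
    have "integral_demand T \<G> C" "\<forall>i\<in>{1..n}. b i \<in> \<nat>"
      using model by (auto simp: Static_Integral \<G>_def integral_demand_def)
    then show ?thesis
      unfolding Static_Integral expected_revenue.simps
      by (intro integral_revenue_bound) (auto simp: q_def Static_Integral sees_all_def fun_eq_iff)
  next
    case (Dynamic_Integral C)
    have "integral_demand T \<G> C" "\<forall>i\<in>{1..n}. b i \<in> \<nat>"
      using model by (auto simp: Dynamic_Integral \<G>_def integral_demand_def)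
    then show ?thesis
      unfolding Dynamic_Integral expected_revenue.simps
      by (intro integral_revenue_bound) (auto simp: q_def Dynamic_Integral sees_in_stock_def fun_eq_iff)
  next
    case (Static_Fractional L)
    have "fractional_demand T \<G> L"
      using model by (auto simp: Static_Fractional \<G>_def fractional_demand_def)
    then show ?thesis
      unfolding Static_Fractional expected_revenue.simps
      by (intro fractional_revenue_bound) (auto simp: q_def Static_Fractional fun_eq_iff)
  qed
  \<comment> \<open>Filtering each draw commutes with forming the product law. Off
    \<open>{1..T}\<close> this relies on \<open>offer\<close> fixing the default
    \<open>{}\<close>.\<close>
  also have "Pi_pmf {1..T} {} \<mu> = algorithm2 T p b \<S> (rate D) x"
  proof -
    have "(\<lambda>S t. {(i, j) \<in> S t. p j > item_revenue T p \<S> (rate D) x i / (2 * b i)}) =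
        (\<lambda>h :: nat \<Rightarrow> assortment. offer \<circ> h)"
      by (simp add: fun_eq_iff offer_def \<theta>_def r_def q_def)
    then show ?thesis
      unfolding \<mu>_def algorithm2_def by (simp add: Pi_pmf_map offer_def)
  qed
  finally show ?thesis .
qed

end
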